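(* Let $m,n,r\ge1$ be integers, $M\in\mathbb{R}^{m\times n}$, and let $f:\mathbb{R}^{m\times r}\times\mathbb{R}^{r\times n}\to\mathbb{R}$ be defined by $f(X,Y)=\|XY-M\|_F^2/2$. If $XY=M$ and $X^TX=YY^T$, then $(X,Y)$ is flat.
   Context: $\|\cdot\|_F$ is the Frobenius norm; the space $\mathbb{R}^{m\times r}\times\mathbb{R}^{r\times n}$ carries the Euclidean norm $\sqrt{\|H\|_F^2+\|K\|_F^2}$. Flatness of a function $f$ on a Euclidean space: let $\mathring f(x,\rho)=\sup_{y\in\overline B_\rho(x)}|f(y)-f(x)|$ with $\overline B_\rho(x)$ the closed ball, and write $x\preceq y$ iff there exists $\overline\rho>0$ such that $\mathring f(x,\rho)\le\mathring f(y,\rho)$ for all $\rho\in(0,\overline\rho]$. A point $\overline x$ is flat if there is a neighborhood $U$ of $\overline x$ in the level set $\{x:f(x)=f(\overline x)\}$ such that $\overline x\preceq x$ for all $x\in U\setminus\{\overline x\}$. *)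

theory Defs
  imports "HOL-Analysis.Analysis"
begin

text \<open>On \<^typ>\<open>real ^ 'n ^ 'm\<close> the library norm is the Frobenius norm, and on the product of two
  matrix spaces it is the Euclidean norm; the two lemmas below record this.\<close>

lemma norm_matrix_frobenius:
  fixes A :: "real ^ 'n ^ 'm"
  shows "norm A = sqrt (\<Sum>i\<in>UNIV. \<Sum>j\<in>UNIV. (A $ i $ j)\<^sup>2)"
  by (simp add: norm_vec_def L2_set_def sum_nonneg)

lemma norm_matrix_pair:
  fixes H :: "real ^ 'r ^ 'm" and K :: "real ^ 'n ^ 'r"
  shows "norm (H, K) = sqrt ((norm H)\<^sup>2 + (norm K)\<^sup>2)"
  by (simp add: norm_Pair)

text \<open>The supremum is taken in \<^typ>\<open>ereal\<close>, so that it is \<open>\<infinity>\<close> (and not an unspecified real) when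
  \<open>f\<close> is unbounded on the ball.\<close>

definition ball_variation :: "('a::euclidean_space \<Rightarrow> real) \<Rightarrow> 'a \<Rightarrow> real \<Rightarrow> ereal" where
  "ball_variation f x \<rho> = (SUP y\<in>cball x \<rho>. ereal \<bar>f y - f x\<bar>)"

definition flatter_eq :: "('a::euclidean_space \<Rightarrow> real) \<Rightarrow> 'a \<Rightarrow> 'a \<Rightarrow> bool" where
  "flatter_eq f x y \<longleftrightarrow>
     (\<exists>\<rho>'>0. \<forall>\<rho>\<in>{0<..\<rho>'}. ball_variation f x \<rho> \<le> ball_variation f y \<rho>)"

definition flat :: "('a::euclidean_space \<Rightarrow> real) \<Rightarrow> 'a \<Rightarrow> bool" where
  "flat f x \<longleftrightarrow>
     (\<exists>U. openin (top_of_set {y. f y = f x}) U \<and> x \<in> U \<and> (\<forall>y\<in>U - {x}. flatter_eq f x y))"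

definition factorization_loss ::
  "real ^ 'n ^ 'm \<Rightarrow> (real ^ 'r ^ 'm) \<times> (real ^ 'n ^ 'r) \<Rightarrow> real" where
  "factorization_loss M = (\<lambda>(X, Y). (norm (X ** Y - M))\<^sup>2 / 2)"

end

theory Submission
  imports Defs
begin

text \<open>
  Let \<open>\<sigma>\<close> be the largest value of \<open>u \<bullet> M v\<close> over unit vectors. At a balanced factorization,
  \<open>(X X\<^sup>T)\<^sup>2 = M M\<^sup>T\<close> forces the operator norms of \<open>X\<close> and \<open>Y\<close> to be at most \<open>\<surd>\<sigma>\<close>, so that
  the residual is at most \<open>\<surd>(2\<sigma>) \<rho> + \<rho>\<^sup>2/2\<close> on the ball of radius \<open>\<rho>\<close>. At an arbitrary
  factorization \<open>X' Y' = M\<close> this value is reached for small \<open>\<rho>\<close> by rank-one perturbations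
  \<open>(u h\<^sup>T, k v\<^sup>T)\<close>, where \<open>u\<close>, \<open>v\<close> attain \<open>\<sigma>\<close>: with \<open>p = X'\<^sup>T u\<close> and \<open>q = Y' v\<close>, so that
  \<open>p \<bullet> q = \<sigma>\<close>, one tests with \<open>h = k\<close> along \<open>p\<close> if \<open>p = q\<close>, while for \<open>p \<noteq> q\<close> the first-order
  term already wins because \<open>|p|\<^sup>2 + |q|\<^sup>2 > 2\<sigma>\<close>.
\<close>

section \<open>Frobenius norms, operator bounds and rank-one matrices\<close>

definition outer_product :: "real ^ 'm \<Rightarrow> real ^ 'n \<Rightarrow> real ^ 'n ^ 'm" where
  "outer_product u v = (\<chi> i j. u $ i * v $ j)"

lemma power2_norm_rows:
  fixes A :: "real ^ 'n ^ 'm"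
  shows "(norm A)\<^sup>2 = (\<Sum>i\<in>UNIV. (norm (A $ i))\<^sup>2)"
  by (simp add: norm_vec_def L2_set_def sum_nonneg)

lemma norm_matrix_transpose:
  fixes A :: "real ^ 'n ^ 'm"
  shows "norm (transpose A) = norm A"
  unfolding norm_matrix_frobenius transpose_def by (simp add: sum.swap[of _ "UNIV :: 'n set"])

lemma matrix_add_rdistrib:
  fixes A B :: "real ^ 'k ^ 'm" and C :: "real ^ 'n ^ 'k"
  shows "(A + B) ** C = A ** C + B ** C"
  by (simp add: matrix_matrix_mult_def vec_eq_iff distrib_right sum.distrib)

lemma norm_outer_product: "norm (outer_product u v) = norm u * norm v"
proof -
  have row: "outer_product u v $ i = (u $ i) *\<^sub>R v" for i
    by (simp add: outer_product_def vec_eq_iff)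
  have "(norm (outer_product u v))\<^sup>2 = (\<Sum>i\<in>UNIV. (u $ i)\<^sup>2) * (norm v)\<^sup>2"
    by (simp add: power2_norm_rows row power_mult_distrib sum_distrib_right)
  also have "\<dots> = (norm u * norm v)\<^sup>2"
    by (simp add: norm_vec_def L2_set_def sum_nonneg power_mult_distrib)
  finally show ?thesis by (rule power2_eq_imp_eq) auto
qed

lemma outer_product_vector_mult: "outer_product u v *v x = (v \<bullet> x) *\<^sub>R u"
  by (simp add: outer_product_def matrix_vector_mult_def vec_eq_iff inner_vec_def
      sum_distrib_right sum_distrib_left mult_ac)

lemma norm_matrix_vector_le:
  fixes A :: "real ^ 'n ^ 'm"
  shows "norm (A *v x) \<le> norm A * norm x"
proof -
  have "norm ((A *v x) $ i) \<le> norm (A $ i) * norm x" for i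
    by (simp add: matrix_vector_mul_component Cauchy_Schwarz_ineq2)
  then have "(\<Sum>i\<in>UNIV. (norm ((A *v x) $ i))\<^sup>2) \<le> (\<Sum>i\<in>UNIV. (norm (A $ i) * norm x)\<^sup>2)"
    by (intro sum_mono power_mono) auto
  then have "(norm (A *v x))\<^sup>2 \<le> (norm A * norm x)\<^sup>2"
    by (simp add: power2_norm_rows power_mult_distrib sum_distrib_right norm_vec_def L2_set_def sum_nonneg)
  then show ?thesis by (rule power2_le_imp_le) auto
qed

text \<open>Each row of \<open>A ** B\<close> is the image of a row of \<open>A\<close> under
  \<open>transpose B\<close>, so the operator bound applies row by row. Paying only the operator
  norm of one factor keeps the first-order constant of the upper estimate sharp.\<close>

lemma norm_matrix_matrix_le_right:
  fixes A :: "real ^ 'k ^ 'm" and B :: "real ^ 'n ^ 'k"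
  assumes "\<And>x. norm (transpose B *v x) \<le> c * norm x" and "c \<ge> 0"
  shows "norm (A ** B) \<le> c * norm A"
proof -
  have row: "(A ** B) $ i = transpose B *v (A $ i)" for i
    by (simp add: matrix_matrix_mult_def matrix_vector_mult_def transpose_def vec_eq_iff mult_ac)
  have "(norm (A ** B))\<^sup>2 = (\<Sum>i\<in>UNIV. (norm (transpose B *v (A $ i)))\<^sup>2)"
    by (simp add: power2_norm_rows row)
  also have "\<dots> \<le> (\<Sum>i\<in>UNIV. (c * norm (A $ i))\<^sup>2)"
    by (intro sum_mono power_mono assms) auto
  also have "\<dots> = (c * norm A)\<^sup>2"
    by (simp add: power2_norm_rows power_mult_distrib sum_distrib_left)
  finally show ?thesis by (rule power2_le_imp_le) (use assms in auto)
qed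

lemma norm_matrix_matrix_le_left:
  fixes A :: "real ^ 'k ^ 'm" and B :: "real ^ 'n ^ 'k"
  assumes "\<And>x. norm (A *v x) \<le> c * norm x" and "c \<ge> 0"
  shows "norm (A ** B) \<le> c * norm B"
proof -
  have "norm (transpose B ** transpose A) \<le> c * norm (transpose B)"
    by (rule norm_matrix_matrix_le_right) (use assms in \<open>auto simp: transpose_transpose\<close>)
  then show ?thesis
    by (simp add: norm_matrix_transpose flip: matrix_transpose_mul)
qed

lemma norm_matrix_matrix_le:
  fixes A :: "real ^ 'k ^ 'm" and B :: "real ^ 'n ^ 'k"
  shows "norm (A ** B) \<le> norm A * norm B"
  by (rule norm_matrix_matrix_le_left) (auto simp: norm_matrix_vector_le)

text \<open>A matrix and its adjoint share operator bounds: expand the square of |A^T y| as y . A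
  (A^T y), use Cauchy-Schwarz and cancel one factor |A^T y|.\<close>

lemma norm_transpose_vector_le:
  fixes A :: "real ^ 'n ^ 'm"
  assumes "\<And>x. norm (A *v x) \<le> c * norm x" and "c \<ge> 0"
  shows "norm (transpose A *v y) \<le> c * norm y"
proof (cases "transpose A *v y = 0")
  case True
  then show ?thesis using \<open>c \<ge> 0\<close> by simp
next
  case False
  have "(norm (transpose A *v y))\<^sup>2 = y \<bullet> (A *v (transpose A *v y))"
    by (simp add: power2_norm_eq_inner dot_lmul_matrix)
  also have "\<dots> \<le> norm y * norm (A *v (transpose A *v y))"
    by (rule norm_cauchy_schwarz)
  also have "\<dots> \<le> norm y * (c * norm (transpose A *v y))"
    by (intro mult_left_mono assms) auto
  finally have "norm (transpose A *v y) * norm (transpose A *v y)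
      \<le> (c * norm y) * norm (transpose A *v y)"
    by (simp add: power2_eq_square mult_ac)
  then show ?thesis using False by simp
qed

section \<open>The extremal value and balanced factors\<close>

lemma bilinear_max_attained:
  fixes M :: "real ^ 'n ^ 'm"
  obtains u v where "norm u = 1" and "norm v = 1"
    and "\<And>x y. x \<bullet> (M *v y) \<le> (u \<bullet> (M *v v)) * (norm x * norm y)"
proof -
  define S where "S = sphere (0 :: real ^ 'm) 1 \<times> sphere (0 :: real ^ 'n) 1"
  have "compact S" unfolding S_def by (intro compact_Times compact_sphere)
  moreover have "S \<noteq> {}" unfolding S_def by simp
  moreover have "continuous_on S (\<lambda>(x, y). x \<bullet> (M *v y))"
    unfolding split_beta
    by (intro continuous_intros matrix_vector_mult_linear_continuous_on
        linear_continuous_on_compose[OF continuous_on_snd[OF continuous_on_id]]) auto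
  ultimately obtain w where w: "w \<in> S"
    and max: "\<forall>z\<in>S. (case z of (x, y) \<Rightarrow> x \<bullet> (M *v y)) \<le> (case w of (x, y) \<Rightarrow> x \<bullet> (M *v y))"
    by (meson continuous_attains_sup)
  obtain u v where uv: "w = (u, v)" by (cases w)
  have "x \<bullet> (M *v y) \<le> (u \<bullet> (M *v v)) * (norm x * norm y)" for x y
  proof (cases "x = 0 \<or> y = 0")
    case False
    then have "(sgn x, sgn y) \<in> S" by (simp add: S_def norm_sgn)
    then have "sgn x \<bullet> (M *v sgn y) \<le> u \<bullet> (M *v v)" using max uv by auto
    then have "x \<bullet> (M *v y) / (norm x * norm y) \<le> u \<bullet> (M *v v)"
      by (simp add: sgn_div_norm matrix_vector_mult_scaleR divide_inverse mult_ac)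
    then show ?thesis using False by (simp add: divide_le_eq)
  qed auto
  then show ?thesis using that[of u v] w uv by (simp add: S_def)
qed

lemma balanced_operator_bound:
  fixes X :: "real ^ 'r ^ 'm" and Y :: "real ^ 'n ^ 'r"
  assumes bal: "transpose X ** X = Y ** transpose Y"
    and M: "\<And>x y. x \<bullet> ((X ** Y) *v y) \<le> \<sigma> * (norm x * norm y)"
    and "\<sigma> \<ge> 0"
  shows "norm (X *v x) \<le> sqrt \<sigma> * norm x" and "norm (transpose Y *v x) \<le> sqrt \<sigma> * norm x"
proof -
  \<comment> \<open>Balance says that X and Y^T have the same Gram matrix, hence stretch every
    vector equally.\<close>
  have iso: "norm (X *v x) = norm (transpose Y *v x)" for x
  proof -
    have "(X *v x) \<bullet> (X *v x) = x \<bullet> ((transpose X ** X) *v x)"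
      by (metis dot_lmul_matrix inner_commute matrix_vector_mul_assoc transpose_matrix_vector)
    also have "\<dots> = (transpose Y *v x) \<bullet> (transpose Y *v x)"
      unfolding bal by (metis dot_lmul_matrix matrix_vector_mul_assoc transpose_matrix_vector)
    finally show ?thesis by (simp add: norm_eq)
  qed
  have "norm (transpose X *v u) \<le> sqrt \<sigma> * norm u" for u
  proof -
    define z where "z = transpose (X ** Y) *v u"
    have "(norm z)\<^sup>2 = u \<bullet> ((X ** Y) *v z)"
      unfolding z_def by (simp add: power2_norm_eq_inner dot_lmul_matrix)
    also have "\<dots> \<le> (\<sigma> * norm u) * norm z" using M[of u z] by (simp add: mult_ac)
    finally have z: "norm z \<le> \<sigma> * norm u"
      using \<open>\<sigma> \<ge> 0\<close> by (cases "z = 0") (auto simp: power2_eq_square)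
    have "(norm (transpose X *v u))\<^sup>2 = u \<bullet> (X *v (transpose X *v u))"
      by (simp add: power2_norm_eq_inner dot_lmul_matrix)
    also have "\<dots> \<le> norm u * norm (X *v (transpose X *v u))"
      by (rule norm_cauchy_schwarz)
    \<comment> \<open>Balance trades the outer X for Y^T, and Y^T X^T u = (X Y)^T u = z, whose norm
      is controlled by \<sigma>.\<close>
    also have "norm (X *v (transpose X *v u)) = norm z"
      unfolding iso z_def by (simp only: matrix_transpose_mul matrix_vector_mul_assoc)
    also have "norm u * norm z \<le> norm u * (\<sigma> * norm u)"
      by (intro mult_left_mono z) auto
    also have "\<dots> = (sqrt \<sigma> * norm u)\<^sup>2"
      using \<open>\<sigma> \<ge> 0\<close> by (simp add: power_mult_distrib) (simp add: power2_eq_square)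
    finally show ?thesis by (rule power2_le_imp_le) (use \<open>\<sigma> \<ge> 0\<close> in auto)
  qed
  from norm_transpose_vector_le[OF this] \<open>\<sigma> \<ge> 0\<close> show "norm (X *v x) \<le> sqrt \<sigma> * norm x"
    by (simp add: transpose_transpose)
  then show "norm (transpose Y *v x) \<le> sqrt \<sigma> * norm x" by (simp add: iso)
qed

section \<open>Residuals under perturbation, from above and from below\<close>

lemma perturbed_residual_le:
  fixes X H :: "real ^ 'r ^ 'm" and Y K :: "real ^ 'n ^ 'r"
  assumes X: "\<And>x. norm (X *v x) \<le> c * norm x"
    and Y: "\<And>x. norm (transpose Y *v x) \<le> c * norm x"
    and "c \<ge> 0" and "norm (H, K) \<le> \<rho>"
  shows "norm ((X + H) ** (Y + K) - X ** Y) \<le> sqrt 2 * c * \<rho> + \<rho>\<^sup>2 / 2"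
proof -
  have HK: "(norm H)\<^sup>2 + (norm K)\<^sup>2 \<le> \<rho>\<^sup>2"
    using assms(4) by (simp add: norm_Pair real_sqrt_le_iff sqrt_le_D)
  have "\<rho> \<ge> 0" using assms(4) norm_ge_zero order_trans by blast
  \<comment> \<open>Equality here and in \<open>lin\<close> requires |H| = |K|, which the test
    vectors for the case p = q satisfy.\<close>
  have prod: "norm H * norm K \<le> \<rho>\<^sup>2 / 2"
    using HK sum_squares_bound[of "norm H" "norm K"] by simp
  have "(norm H + norm K)\<^sup>2 \<le> (sqrt 2 * \<rho>)\<^sup>2"
    using HK prod by (simp add: power2_sum power_mult_distrib)
  then have lin: "norm H + norm K \<le> sqrt 2 * \<rho>"
    by (rule power2_le_imp_le) (use \<open>\<rho> \<ge> 0\<close> in auto)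
  have "(X + H) ** (Y + K) - X ** Y = X ** K + H ** Y + H ** K"
    by (simp add: matrix_add_ldistrib matrix_add_rdistrib)
  also have "norm \<dots> \<le> norm (X ** K) + norm (H ** Y) + norm (H ** K)"
    by (meson add_mono norm_triangle_ineq order_refl order_trans)
  also have "\<dots> \<le> c * norm K + c * norm H + norm H * norm K"
    by (intro add_mono norm_matrix_matrix_le norm_matrix_matrix_le_left[OF X]
        norm_matrix_matrix_le_right[OF Y] \<open>c \<ge> 0\<close>)
  also have "\<dots> \<le> c * (sqrt 2 * \<rho>) + \<rho>\<^sup>2 / 2"
    using mult_left_mono[OF lin \<open>c \<ge> 0\<close>] prod by (simp add: algebra_simps)
  finally show ?thesis by (simp add: mult_ac)
qed

text \<open>As u and v are unit vectors, the left side is exactly u . R v for the residual R, and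
  this never exceeds the Frobenius norm of R.\<close>

lemma rank_one_residual_ge:
  fixes X :: "real ^ 'r ^ 'm" and Y :: "real ^ 'n ^ 'r"
  assumes u: "norm u = 1" and v: "norm v = 1"
  shows "(transpose X *v u) \<bullet> k + h \<bullet> (Y *v v) + h \<bullet> k
    \<le> norm ((X + outer_product u h) ** (Y + outer_product k v) - X ** Y)" (is "?l \<le> norm ?R")
proof -
  have uu: "u \<bullet> u = 1" and vv: "v \<bullet> v = 1" using u v by (simp_all add: norm_eq_1)
  have "?R *v v = X *v k + (h \<bullet> (Y *v v)) *\<^sub>R u + (h \<bullet> k) *\<^sub>R u"
    by (simp add: matrix_vector_mult_diff_rdistrib matrix_vector_mult_add_rdistrib
        matrix_vector_right_distrib outer_product_vector_mult vv inner_add_right scaleR_add_left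
        flip: matrix_vector_mul_assoc)
  then have "?l = u \<bullet> (?R *v v)"
    by (simp add: inner_add_right uu dot_lmul_matrix)
  also have "\<dots> \<le> norm u * norm (?R *v v)" by (rule norm_cauchy_schwarz)
  also have "\<dots> \<le> norm ?R" using norm_matrix_vector_le[of ?R v] by (simp add: u v)
  finally show ?thesis .
qed

text \<open>The rank-one lower bound only involves p and q, so it remains to make it reach the upper
  bound of the balanced point. The radius found for distinct p and q tends to 0 as they merge, so p
  = q needs its own choice.\<close>

lemma rank_one_test_vectors:
  fixes p q :: "'a :: euclidean_space"
  assumes nonneg: "p \<bullet> q \<ge> 0"
  shows "\<exists>\<rho>'>0. \<forall>\<rho>\<in>{0<..\<rho>'}. \<exists>h k. (norm h)\<^sup>2 + (norm k)\<^sup>2 = \<rho>\<^sup>2 \<and>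
    sqrt 2 * sqrt (p \<bullet> q) * \<rho> + \<rho>\<^sup>2 / 2 \<le> p \<bullet> k + h \<bullet> q + h \<bullet> k"
proof (cases "p = q")
  case True
  \<comment> \<open>For p = 0 any unit vector serves: the linear terms vanish and h . k alone
    supplies the quadratic term.\<close>
  obtain w :: 'a where w: "norm w = 1" "p = norm p *\<^sub>R w"
  proof (cases "p = 0")
    case True
    then show ?thesis using that vector_choose_size[of 1] by auto
  next
    case False
    then show ?thesis using that[of "sgn p"] by (simp add: norm_sgn sgn_div_norm)
  qed
  have pw: "p \<bullet> w = norm p"
    using w by (metis inner_scaleR_left mult.right_neutral norm_eq_1)
  have "\<exists>h k. (norm h)\<^sup>2 + (norm k)\<^sup>2 = \<rho>\<^sup>2 \<and>
    sqrt 2 * sqrt (p \<bullet> q) * \<rho> + \<rho>\<^sup>2 / 2 \<le> p \<bullet> k + h \<bullet> q + h \<bullet> k" for \<rho>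
  proof (intro exI conjI)
    let ?h = "(\<rho> / sqrt 2) *\<^sub>R w"
    show "(norm ?h)\<^sup>2 + (norm ?h)\<^sup>2 = \<rho>\<^sup>2" by (simp add: w power_divide)
    have ww: "w \<bullet> w = 1" using w by (simp add: norm_eq_1)
    have "p \<bullet> ?h + ?h \<bullet> q + ?h \<bullet> ?h = 2 * (\<rho> / sqrt 2) * norm p + (\<rho> / sqrt 2)\<^sup>2"
      using True pw ww by (simp add: inner_commute power2_eq_square)
    also have "2 * (\<rho> / sqrt 2) = sqrt 2 * \<rho>"
      by (simp add: field_simps)
    finally show "sqrt 2 * sqrt (p \<bullet> q) * \<rho> + \<rho>\<^sup>2 / 2 \<le> p \<bullet> ?h + ?h \<bullet> q + ?h \<bullet> ?h"
      using True by (simp add: power_divide norm_eq_sqrt_inner mult_ac)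
  qed
  then show ?thesis by (intro exI[of _ 1]) auto
next
  case False
  define N where "N = norm (p, q)"
  have N2: "N\<^sup>2 = p \<bullet> p + q \<bullet> q"
    by (simp add: N_def norm_Pair power2_norm_eq_inner)
  have "0 < (p - q) \<bullet> (p - q)" using False by simp
  then have gap: "2 * (p \<bullet> q) < N\<^sup>2"
    by (simp add: N2 inner_diff inner_commute)
  have "N \<ge> 0" by (simp add: N_def)
  then have strict: "sqrt 2 * sqrt (p \<bullet> q) < N"
    using gap by (simp add: real_less_lsqrt flip: real_sqrt_mult)
  then have "N > 0" using nonneg by (meson le_less_trans mult_nonneg_nonneg real_sqrt_ge_zero zero_le_numeral)
  have "\<exists>h k. (norm h)\<^sup>2 + (norm k)\<^sup>2 = \<rho>\<^sup>2 \<and>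
      sqrt 2 * sqrt (p \<bullet> q) * \<rho> + \<rho>\<^sup>2 / 2 \<le> p \<bullet> k + h \<bullet> q + h \<bullet> k"
    if \<rho>: "\<rho> \<in> {0<..2 * (N - sqrt 2 * sqrt (p \<bullet> q))}" for \<rho>
  proof (intro exI conjI)
    \<comment> \<open>By Cauchy-Schwarz, (h, k) parallel to (q, p) maximizes the linear part on the
      sphere of radius \<rho>, with value \<rho> N.\<close>
    let ?h = "(\<rho> / N) *\<^sub>R q" and ?k = "(\<rho> / N) *\<^sub>R p"
    have "(norm ?h)\<^sup>2 + (norm ?k)\<^sup>2 = (\<rho> / N)\<^sup>2 * N\<^sup>2"
      unfolding N2 norm_scaleR power_mult_distrib power2_abs power2_norm_eq_inner
      by (simp add: algebra_simps)
    then show "(norm ?h)\<^sup>2 + (norm ?k)\<^sup>2 = \<rho>\<^sup>2" using \<open>N > 0\<close> by (simp add: power_divide)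
    have "p \<bullet> ?k + ?h \<bullet> q = \<rho> / N * N\<^sup>2" by (simp add: N2 algebra_simps)
    also have "\<dots> = \<rho> * N" using \<open>N > 0\<close> by (simp add: power2_eq_square)
    finally have first: "p \<bullet> ?k + ?h \<bullet> q = \<rho> * N" .
    have "0 \<le> ?h \<bullet> ?k" using nonneg \<rho> by (simp add: inner_commute zero_le_mult_iff)
    \<comment> \<open>The restriction on \<rho> lets the first-order surplus absorb the quadratic
      term of the target, so h . k need only be nonnegative.\<close>
    moreover have "\<rho> * (sqrt 2 * sqrt (p \<bullet> q) + \<rho> / 2) \<le> \<rho> * N"
      using \<rho> by (intro mult_left_mono) auto
    ultimately show "sqrt 2 * sqrt (p \<bullet> q) * \<rho> + \<rho>\<^sup>2 / 2 \<le> p \<bullet> ?k + ?h \<bullet> q + ?h \<bullet> ?k"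
      unfolding first by (simp add: algebra_simps power2_eq_square)
  qed
  then show ?thesis using strict by (intro exI[of _ "2 * (N - sqrt 2 * sqrt (p \<bullet> q))"]) auto
qed

section \<open>Flatness of balanced factorizations\<close>

theorem corollary4p27:
  fixes M :: "real ^ 'n ^ 'm"
    and X :: "real ^ 'r ^ 'm"
    and Y :: "real ^ 'n ^ 'r"
  assumes "X ** Y = M"
    and "transpose X ** X = Y ** transpose Y"
  shows "flat (factorization_loss M) (X, Y)"
proof -
  let ?f = "factorization_loss M :: (real ^ 'r ^ 'm) \<times> (real ^ 'n ^ 'r) \<Rightarrow> real"
  obtain u :: "real ^ 'm" and v :: "real ^ 'n" where uv: "norm u = 1" "norm v = 1"
    and max: "\<And>x y. x \<bullet> (M *v y) \<le> (u \<bullet> (M *v v)) * (norm x * norm y)"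
    using bilinear_max_attained by blast
  define \<sigma> where "\<sigma> = u \<bullet> (M *v v)"
  \<comment> \<open>Replacing u by -u in the maximality gives -\<sigma> \<le> \<sigma>.\<close>
  have "\<sigma> \<ge> 0" using max[of "-u" v] uv by (simp add: \<sigma>_def)
  have bound: "norm (X *v x) \<le> sqrt \<sigma> * norm x" "norm (transpose Y *v x) \<le> sqrt \<sigma> * norm x" for x
    using balanced_operator_bound[OF assms(2), of \<sigma>] max \<open>\<sigma> \<ge> 0\<close>
    by (auto simp: assms(1) \<sigma>_def)
  have zero: "?f (X, Y) = 0" using assms(1) by (simp add: factorization_loss_def)
  have "flatter_eq ?f (X, Y) (X', Y')" if "?f (X', Y') = 0" for X' Y'
  proof -
    have M': "X' ** Y' = M" using that by (simp add: factorization_loss_def)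
    define p where "p = transpose X' *v u"
    define q where "q = Y' *v v"
    \<comment> \<open>The inner product of p and q is u . X' Y' v, hence the same for every
      factorization of M; only their lengths and angle vary.\<close>
    have pq: "p \<bullet> q = \<sigma>"
      by (simp add: p_def q_def \<sigma>_def dot_lmul_matrix matrix_vector_mul_assoc M')
    obtain \<rho>' where "\<rho>' > 0" and test: "\<And>\<rho>. \<rho> \<in> {0<..\<rho>'} \<Longrightarrow> \<exists>h k. (norm h)\<^sup>2 + (norm k)\<^sup>2 = \<rho>\<^sup>2 \<and>
      sqrt 2 * sqrt \<sigma> * \<rho> + \<rho>\<^sup>2 / 2 \<le> p \<bullet> k + h \<bullet> q + h \<bullet> k"
      using rank_one_test_vectors[of p q] \<open>\<sigma> \<ge> 0\<close> unfolding pq by blast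
    have "ball_variation ?f (X, Y) \<rho> \<le> ball_variation ?f (X', Y') \<rho>" if \<rho>: "\<rho> \<in> {0<..\<rho>'}" for \<rho>
    proof -
      let ?b = "sqrt 2 * sqrt \<sigma> * \<rho> + \<rho>\<^sup>2 / 2"
      have "?b \<ge> 0" using \<rho> \<open>\<sigma> \<ge> 0\<close> by simp
      obtain h k where hk: "(norm h)\<^sup>2 + (norm k)\<^sup>2 = \<rho>\<^sup>2" "?b \<le> p \<bullet> k + h \<bullet> q + h \<bullet> k"
        using test[OF \<rho>] by blast
      define y where "y = (X' + outer_product u h, Y' + outer_product k v)"
      have "(X', Y') - y = - (outer_product u h, outer_product k v)"
        by (simp add: y_def)
      then have "dist (X', Y') y = norm (outer_product u h, outer_product k v)"
        by (simp only: dist_norm norm_minus_cancel)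
      \<comment> \<open>Since u and v are unit vectors, the outer products have norms |h| and |k|,
        so y lies at distance exactly \<rho>.\<close>
      then have "y \<in> cball (X', Y') \<rho>"
        using \<rho> by (simp add: norm_Pair norm_outer_product uv hk(1))
      have "?b \<le> norm ((X' + outer_product u h) ** (Y' + outer_product k v) - M)"
        using rank_one_residual_ge[OF uv, of X' k h Y'] hk(2) by (simp add: p_def q_def M')
      then have lower: "?b\<^sup>2 / 2 \<le> \<bar>?f y - ?f (X', Y')\<bar>"
        using \<open>?b \<ge> 0\<close> by (simp add: y_def factorization_loss_def M' power_mono)
      have upper: "\<bar>?f z - ?f (X, Y)\<bar> \<le> ?b\<^sup>2 / 2" if z: "z \<in> cball (X, Y) \<rho>" for z
      proof -
        obtain H K where HK: "z = (X + H, Y + K)"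
          by (metis add_diff_cancel_left' diff_add_cancel add.commute surj_pair)
        then have "(X, Y) - z = - (H, K)" by simp
        then have "norm (H, K) \<le> \<rho>" 
          using z by (simp only: mem_cball dist_norm norm_minus_cancel)
        then have "norm ((X + H) ** (Y + K) - M) \<le> ?b"
          using perturbed_residual_le[OF bound, of H K \<rho>] \<open>\<sigma> \<ge> 0\<close> by (simp add: assms(1))
        then show ?thesis
          by (simp add: HK factorization_loss_def assms(1) power_mono)
      qed
      have "ball_variation ?f (X, Y) \<rho> \<le> ereal (?b\<^sup>2 / 2)"
        unfolding ball_variation_def by (intro SUP_least) (use upper in auto)
      also have "\<dots> \<le> ereal \<bar>?f y - ?f (X', Y')\<bar>" using lower by simp
      also have "\<dots> \<le> ball_variation ?f (X', Y') \<rho>"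
        unfolding ball_variation_def using \<open>y \<in> cball (X', Y') \<rho>\<close> by (rule SUP_upper)
      finally show ?thesis .
    qed
    then show ?thesis unfolding flatter_eq_def using \<open>\<rho>' > 0\<close> by blast
  qed
  \<comment> \<open>The comparison holds with every other factorization of M, so the whole level set
    serves as the neighborhood.\<close>
  then show ?thesis
    unfolding flat_def
    by (intro exI[of _ "{y. ?f y = ?f (X, Y)}"]) (auto simp: zero)
qed

end
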